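(* Let $F$ be a field of characteristic zero and suppose that $A$ is a finite subset of $\mathbb N$ of order $n$. If $E$ is a $\Delta$-primitive idempotent in $F\Pi_A$, then $\frac1{n!}\,\overline{E}$ is a $\Delta$-primitive idempotent in $\mathcal B_A$.
   Context: For a finite subset $A$ of $\mathbb N=\{1,2,\ldots\}$, a set composition of $A$ is a tuple $P=(P_1,\ldots,P_l)$ of mutually disjoint non-empty subsets of $A$ with union $A$; $\Pi_A$ is the set of all set compositions of $A$. $\Pi_\emptyset$ consists of the empty tuple, denoted $\emptyset$. $F\Pi_A$ is the $F$-vector space with basis $\Pi_A$, an associative algebra with identity under the bilinear product $(P_1,\ldots,P_l)\wedge(Q_1,\ldots,Q_k)=(P_1\cap Q_1,\ldots,P_1\cap Q_k,\ldots,P_l\cap Q_1,\ldots,P_l\cap Q_k)$ with empty sets deleted. $F\Pi=\bigoplus_AF\Pi_A$ over all finite $A\subset\mathbb N$. The coproduct $\Delta:F\Pi\to F\Pi\otimes F\Pi$ is the linear map with $\Delta(P)=\sum_{X\subseteq A}P|_X\otimes P|_{A\setminus X}$ for $P\in\Pi_A$, where $P|_X$ is $(P_1\cap X,\ldots,P_l\cap X)$ with empty sets deleted. A $\Delta$-primitive idempotent is a non-zero element $E$ with $\Delta(E)=E\otimes\emptyset+\emptyset\otimes E$ and $E\wedge E=E$. The symmetric group $S_A$ on $A$ acts on $\Pi_A$ by $(P_1,\ldots,P_l)^\pi=(P_1\pi,\ldots,P_l\pi)$, extended linearly to $F\Pi_A$; $\mathcal B_A$ is the subalgebra of $S_A$-invariants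 in $F\Pi_A$; and $\overline f=\sum_{\pi\in S_A}f^\pi$ for $f\in F\Pi_A$. *)

theory Defs
  imports
    Complex_Main
    "HOL-Library.Poly_Mapping"
    "HOL-Library.Disjoint_Sets"
    "HOL-Combinatorics.Permutations"
begin

section \<open>Set compositions\<close>

text \<open>Since blocks are non-empty, \<open>distinct\<close> together with \<open>partition_on\<close> says exactly that
  the entries at different positions of the tuple are disjoint.\<close>

definition set_comps :: "nat set \<Rightarrow> nat set list set" where
  "set_comps A = {P. distinct P \<and> partition_on A (set P)}"

definition del_empty :: "nat set list \<Rightarrow> nat set list" where
  "del_empty P = filter (\<lambda>B. B \<noteq> {}) P"

definition comp_wedge :: "nat set list \<Rightarrow> nat set list \<Rightarrow> nat set list" where
  "comp_wedge P Q = del_empty (concat (map (\<lambda>p. map (\<lambda>q. p \<inter> q) Q) P))"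

definition comp_restrict :: "nat set list \<Rightarrow> nat set \<Rightarrow> nat set list" where
  "comp_restrict P X = del_empty (map (\<lambda>B. B \<inter> X) P)"

definition comp_act :: "(nat \<Rightarrow> nat) \<Rightarrow> nat set list \<Rightarrow> nat set list" where
  "comp_act \<pi> P = map (\<lambda>B. \<pi> ` B) P"


section \<open>Linear extension to formal linear combinations\<close>

text \<open>The type \<open>'b \<Rightarrow>\<^sub>0 'f\<close> is the vector space over \<open>'f\<close> with basis \<open>'b\<close>; the basis vector
  of \<open>P\<close> is \<open>Poly_Mapping.single P 1\<close>. The tensor product of two such spaces is the space with
  basis the pairs of basis elements.\<close>

definition scale :: "'f::field \<Rightarrow> ('b \<Rightarrow>\<^sub>0 'f) \<Rightarrow> ('b \<Rightarrow>\<^sub>0 'f)" where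
  "scale c f = Poly_Mapping.map (\<lambda>x. c * x) f"

definition lin_ext :: "('b \<Rightarrow> ('c \<Rightarrow>\<^sub>0 'f::field)) \<Rightarrow> ('b \<Rightarrow>\<^sub>0 'f) \<Rightarrow> ('c \<Rightarrow>\<^sub>0 'f)" where
  "lin_ext \<phi> f = (\<Sum>P\<in>Poly_Mapping.keys f. scale (Poly_Mapping.lookup f P) (\<phi> P))"

definition bilin_ext ::
  "('b \<Rightarrow> 'c \<Rightarrow> ('d \<Rightarrow>\<^sub>0 'f::field)) \<Rightarrow> ('b \<Rightarrow>\<^sub>0 'f) \<Rightarrow> ('c \<Rightarrow>\<^sub>0 'f) \<Rightarrow> ('d \<Rightarrow>\<^sub>0 'f)" where
  "bilin_ext \<phi> f g = lin_ext (\<lambda>P. lin_ext (\<lambda>Q. \<phi> P Q) g) f"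

definition tensor :: "('b \<Rightarrow>\<^sub>0 'f::field) \<Rightarrow> ('c \<Rightarrow>\<^sub>0 'f) \<Rightarrow> ('b \<times> 'c \<Rightarrow>\<^sub>0 'f)" where
  "tensor = bilin_ext (\<lambda>P Q. Poly_Mapping.single (P, Q) 1)"


section \<open>The algebras and the coproduct\<close>

text \<open>The operations below are defined on all formal combinations of lists of sets. They have
  their intended meaning on \<open>FPi\<close> (for \<open>wedge\<close>: both arguments in the same \<open>FPi_on A\<close>).\<close>

definition FPi_on :: "nat set \<Rightarrow> (nat set list \<Rightarrow>\<^sub>0 'f::field) set" where
  "FPi_on A = {f. Poly_Mapping.keys f \<subseteq> set_comps A}"

definition FPi :: "(nat set list \<Rightarrow>\<^sub>0 'f::field) set" where
  "FPi = {f. Poly_Mapping.keys f \<subseteq> (\<Union>A\<in>{A. finite A \<and> A \<subseteq> {1..}}. set_comps A)}"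

definition wedge ::
  "(nat set list \<Rightarrow>\<^sub>0 'f::field) \<Rightarrow> (nat set list \<Rightarrow>\<^sub>0 'f) \<Rightarrow> (nat set list \<Rightarrow>\<^sub>0 'f)" where
  "wedge = bilin_ext (\<lambda>P Q. Poly_Mapping.single (comp_wedge P Q) 1)"

text \<open>A set composition \<open>P\<close> determines its ground set \<open>A\<close> as the union of its blocks.\<close>

definition coprod ::
  "(nat set list \<Rightarrow>\<^sub>0 'f::field) \<Rightarrow> (nat set list \<times> nat set list \<Rightarrow>\<^sub>0 'f)" where
  "coprod = lin_ext (\<lambda>P. let A = \<Union>(set P) in
     \<Sum>X\<in>Pow A. Poly_Mapping.single (comp_restrict P X, comp_restrict P (A - X)) 1)"

definition empty_comp :: "nat set list \<Rightarrow>\<^sub>0 'f::field" where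
  "empty_comp = Poly_Mapping.single [] 1"

definition delta_primitive_idempotent :: "(nat set list \<Rightarrow>\<^sub>0 'f::field) \<Rightarrow> bool" where
  "delta_primitive_idempotent E \<longleftrightarrow>
     E \<in> FPi \<and> E \<noteq> 0 \<and>
     coprod E = tensor E empty_comp + tensor empty_comp E \<and>
     wedge E E = E"


section \<open>The action of the symmetric group\<close>

definition act :: "(nat \<Rightarrow> nat) \<Rightarrow> (nat set list \<Rightarrow>\<^sub>0 'f::field) \<Rightarrow> (nat set list \<Rightarrow>\<^sub>0 'f)" where
  "act \<pi> = lin_ext (\<lambda>P. Poly_Mapping.single (comp_act \<pi> P) 1)"

definition invariants :: "nat set \<Rightarrow> (nat set list \<Rightarrow>\<^sub>0 'f::field) set" where
  "invariants A = {f \<in> FPi_on A. \<forall>\<pi>. \<pi> permutes A \<longrightarrow> act \<pi> f = f}"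

definition orbit_sum :: "nat set \<Rightarrow> (nat set list \<Rightarrow>\<^sub>0 'f::field) \<Rightarrow> (nat set list \<Rightarrow>\<^sub>0 'f)" where
  "orbit_sum A f = (\<Sum>\<pi> | \<pi> permutes A. act \<pi> f)"

end

theory Submission
  imports Defs
begin

text \<open>
  For a set composition \<open>Q = (Q\<^sub>1, \<dots>, Q\<^sub>k)\<close> of \<open>A\<close>, the product \<open>Q \<and> P\<close> is the concatenation of the
  restrictions of \<open>P\<close> to \<open>Q\<^sub>1, \<dots>, Q\<^sub>k\<close>. Hence \<open>Q \<and> f\<close> is obtained from the coproduct of \<open>f\<close> by selecting the
  terms whose left factor is a composition of \<open>Q\<^sub>1\<close>, refining the right factors by
  \<open>(Q\<^sub>2, \<dots>, Q\<^sub>k)\<close> and concatenating. If \<open>f\<close> is primitive and \<open>k \<ge> 2\<close>, no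
  term is selected, because \<open>Q\<^sub>1\<close> is neither empty nor all of \<open>A\<close>; so \<open>Q \<and> f = 0\<close>
  (\<open>basis_wedge_primitive\<close>). Since the one-block composition \<open>(A)\<close> is a left identity, \<open>g \<and> f\<close> is
  \<open>f\<close> multiplied by the coefficient of \<open>(A)\<close> in \<open>g\<close> (\<open>wedge_primitive\<close>). A non-zero primitive element
  of \<open>F\<Pi>\<^sub>A\<close> is therefore idempotent exactly when its coefficient at \<open>(A)\<close> is \<open>1\<close>.

  Averaging over the symmetric group preserves both conditions. The coproduct is equivariant,
  so primitive elements are mapped to primitive elements (\<open>primitive_act\<close>), and \<open>(A)\<close> is fixed by every
  permutation of \<open>A\<close>, so the average of \<open>E\<close> again has coefficient \<open>1\<close> at \<open>(A)\<close>; in particular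
  it is not zero. The empty ground set has no composition \<open>({})\<close>, but it also has no
  non-zero primitive element (\<open>primitive_ground_set_nonempty\<close>).
\<close>

section \<open>Linear extensions\<close>

lemma lookup_scale: "Poly_Mapping.lookup (scale c f) k = c * Poly_Mapping.lookup f k"
  unfolding scale_def by (simp add: Poly_Mapping.map.rep_eq when_def)

lemma scale_zero_right [simp]: "scale c 0 = 0"
  by (rule poly_mapping_eqI) (simp add: lookup_scale)

lemma scale_zero_left [simp]: "scale 0 f = 0"
  by (rule poly_mapping_eqI) (simp add: lookup_scale)

lemma scale_one [simp]: "scale 1 f = f"
  by (rule poly_mapping_eqI) (simp add: lookup_scale)

lemma scale_add: "scale c (f + g) = scale c f + scale c g"
  by (rule poly_mapping_eqI) (simp add: lookup_scale lookup_add algebra_simps)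

lemma keys_scale: "Poly_Mapping.keys (scale c f) \<subseteq> Poly_Mapping.keys f"
  by (auto simp: in_keys_iff lookup_scale)

lemma lookup_lin_ext_superset:
  assumes "finite K" "Poly_Mapping.keys f \<subseteq> K"
  shows "Poly_Mapping.lookup (lin_ext \<phi> f) k
    = (\<Sum>P\<in>K. Poly_Mapping.lookup f P * Poly_Mapping.lookup (\<phi> P) k)"
proof -
  have "Poly_Mapping.lookup (lin_ext \<phi> f) k
    = (\<Sum>P\<in>Poly_Mapping.keys f. Poly_Mapping.lookup f P * Poly_Mapping.lookup (\<phi> P) k)"
    by (simp add: lin_ext_def lookup_sum lookup_scale)
  also have "\<dots> = (\<Sum>P\<in>K. Poly_Mapping.lookup f P * Poly_Mapping.lookup (\<phi> P) k)"
    using assms by (intro sum.mono_neutral_left) (auto simp: in_keys_iff)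
  finally show ?thesis .
qed

lemma lin_ext_zero [simp]: "lin_ext \<phi> 0 = 0"
  by (simp add: lin_ext_def)

lemma lin_ext_single: "lin_ext \<phi> (Poly_Mapping.single P c) = scale c (\<phi> P)"
  by (simp add: lin_ext_def)

lemma lin_ext_add: "lin_ext \<phi> (f + g) = lin_ext \<phi> f + lin_ext \<phi> g"
proof (rule poly_mapping_eqI)
  fix k
  let ?K = "Poly_Mapping.keys f \<union> Poly_Mapping.keys g"
  have "Poly_Mapping.keys (f + g) \<subseteq> ?K"
    by (rule Poly_Mapping.keys_add)
  then show "Poly_Mapping.lookup (lin_ext \<phi> (f + g)) k
    = Poly_Mapping.lookup (lin_ext \<phi> f + lin_ext \<phi> g) k"
    by (simp add: lookup_lin_ext_superset[of ?K] lookup_add sum.distrib algebra_simps)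
qed

lemma lin_ext_scale: "lin_ext \<phi> (scale c f) = scale c (lin_ext \<phi> f)"
  by (rule poly_mapping_eqI)
    (simp add: lookup_lin_ext_superset[of "Poly_Mapping.keys f"] keys_scale
      lookup_scale sum_distrib_left mult.assoc)

lemma lin_ext_sum: "lin_ext \<phi> (\<Sum>i\<in>I. f i) = (\<Sum>i\<in>I. lin_ext \<phi> (f i))"
  by (induction I rule: infinite_finite_induct) (simp_all add: lin_ext_add)

lemma lin_ext_cong:
  assumes "\<And>P. P \<in> Poly_Mapping.keys f \<Longrightarrow> \<phi> P = \<psi> P"
  shows "lin_ext \<phi> f = lin_ext \<psi> f"
  unfolding lin_ext_def using assms by simp

lemma lin_ext_lin_ext: "lin_ext \<psi> (lin_ext \<phi> f) = lin_ext (\<lambda>P. lin_ext \<psi> (\<phi> P)) f"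
  by (simp add: lin_ext_def[of \<phi>] lin_ext_def[of "\<lambda>P. lin_ext \<psi> (\<phi> P)"] lin_ext_sum lin_ext_scale)

lemma lin_ext_const_zero: "lin_ext (\<lambda>_. 0) f = 0"
  by (simp add: lin_ext_def)

lemma lin_ext_basis: "lin_ext (\<lambda>P. Poly_Mapping.single P 1) f = f"
proof (rule poly_mapping_eqI)
  fix k
  have "Poly_Mapping.lookup (lin_ext (\<lambda>P. Poly_Mapping.single P 1) f) k
    = (\<Sum>P\<in>Poly_Mapping.keys f. if P = k then Poly_Mapping.lookup f P else 0)"
    by (simp add: lookup_lin_ext_superset[OF _ order_refl] lookup_single when_def if_distrib
        cong: if_cong)
  then show "Poly_Mapping.lookup (lin_ext (\<lambda>P. Poly_Mapping.single P 1) f) k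
    = Poly_Mapping.lookup f k"
    by (simp add: in_keys_iff)
qed

lemma tensor_empty_right:
  "tensor f empty_comp = lin_ext (\<lambda>P. Poly_Mapping.single (P, []) 1) f"
  by (simp add: tensor_def bilin_ext_def empty_comp_def lin_ext_single)

lemma tensor_empty_left:
  "tensor empty_comp f = lin_ext (\<lambda>P. Poly_Mapping.single ([], P) 1) f"
  by (simp add: tensor_def bilin_ext_def empty_comp_def lin_ext_single)


section \<open>Multiplication by primitive elements\<close>

definition primitive :: "(nat set list \<Rightarrow>\<^sub>0 'f::field) \<Rightarrow> bool" where
  "primitive f \<longleftrightarrow> coprod f = tensor f empty_comp + tensor empty_comp f"

lemma set_comps_Union: "P \<in> set_comps A \<Longrightarrow> \<Union>(set P) = A"
  by (auto simp: set_comps_def partition_on_def)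

lemma Union_comp_restrict: "\<Union>(set (comp_restrict P X)) = \<Union>(set P) \<inter> X"
  by (auto simp: comp_restrict_def del_empty_def)

lemma comp_wedge_Nil: "comp_wedge [] P = []"
  by (simp add: comp_wedge_def del_empty_def)

lemma comp_wedge_Cons: "comp_wedge (B # Q) P = comp_restrict P B @ comp_wedge Q P"
  by (simp add: comp_wedge_def del_empty_def comp_restrict_def Int_commute[of _ B])

lemma comp_restrict_restrict:
  assumes "X \<subseteq> Y"
  shows "comp_restrict (comp_restrict P Y) X = comp_restrict P X"
proof -
  have eq: "B \<inter> Y \<inter> X = B \<inter> X" for B
    using assms by auto
  show ?thesis
    unfolding comp_restrict_def del_empty_def
    by (induction P) (use assms in \<open>auto simp: eq\<close>)
qed

text \<open>Lets the remaining blocks of \<open>Q\<close> act on the right tensor factor \<open>P|\<^sub>A\<^sub>-\<^sub>B\<close> instead of on \<open>P\<close>.\<close>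

lemma comp_wedge_restrict:
  assumes "\<Union>(set Q) \<subseteq> X"
  shows "comp_wedge Q (comp_restrict P X) = comp_wedge Q P"
  using assms by (induction Q) (simp_all add: comp_wedge_Nil comp_wedge_Cons comp_restrict_restrict)

lemma comp_wedge_whole:
  assumes "P \<in> set_comps A"
  shows "comp_wedge [A] P = P"
proof -
  have "B \<inter> A = B" "B \<noteq> {}" if "B \<in> set P" for B
    using assms that by (auto simp: set_comps_def partition_on_def)
  then show ?thesis
    unfolding comp_wedge_Cons comp_wedge_Nil comp_restrict_def del_empty_def
    by (simp add: map_idI filter_id_conv)
qed

lemma wedge_conv_basis:
  "wedge g f = lin_ext (\<lambda>Q. wedge (Poly_Mapping.single Q 1) f) g"
  by (simp add: wedge_def bilin_ext_def lin_ext_single)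

lemma basis_wedge:
  "wedge (Poly_Mapping.single Q 1) f
    = lin_ext (\<lambda>P. Poly_Mapping.single (comp_wedge Q P) 1) f"
  by (simp add: wedge_def bilin_ext_def lin_ext_single)

text \<open>The map \<open>m\<close> in the proof recovers \<open>Q \<and> f\<close> from the coproduct of \<open>f\<close>: it picks, for every \<open>P\<close>,
  the single term \<open>P|\<^sub>B \<otimes> P|\<^sub>A\<^sub>-\<^sub>B\<close> with \<open>B\<close> the first block of \<open>Q\<close>. On the primitive side, the
  left factors have ground set \<open>A\<close> or \<open>{}\<close>, and \<open>B\<close> is neither.\<close>

lemma basis_wedge_primitive:
  assumes "finite A" and f: "f \<in> FPi_on A" "primitive f"
    and Q: "Q \<in> set_comps A" "Q \<noteq> []" "Q \<noteq> [A]"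
  shows "wedge (Poly_Mapping.single Q 1) f = 0"
proof -
  obtain B R where QBR: "Q = B # R"
    using Q(2) by (cases Q) auto
  have part: "partition_on A (set Q)" "distinct Q"
    using Q(1) by (auto simp: set_comps_def)
  have B: "B \<noteq> {}" "B \<subseteq> A"
    using part(1) by (auto simp: QBR partition_on_def)
  have "C \<inter> B = {}" if "C \<in> set R" for C
    using part that unfolding QBR partition_on_def disjoint_def
    by (metis distinct.simps(2) list.set_intros(1,2))
  moreover have "\<Union>(set R) \<subseteq> A"
    using part(1) by (auto simp: QBR partition_on_def)
  ultimately have R: "\<Union>(set R) \<subseteq> A - B"
    by blast
  have "B \<noteq> A"
  proof
    assume "B = A"
    with R part(1) have "R = []"
      by (cases R) (auto simp: QBR partition_on_def)
    with \<open>B = A\<close> QBR Q(3) show False by simp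
  qed
  define m :: "nat set list \<times> nat set list \<Rightarrow> (nat set list \<Rightarrow>\<^sub>0 'a)" where
    "m = (\<lambda>(S, T). if \<Union>(set S) = B then Poly_Mapping.single (S @ comp_wedge R T) 1 else 0)"
  have keys: "P \<in> set_comps A" if "P \<in> Poly_Mapping.keys f" for P
    using f(1) that by (auto simp: FPi_on_def)
  have m_term: "(\<Sum>X\<in>Pow A. m (comp_restrict P X, comp_restrict P (A - X)))
      = Poly_Mapping.single (comp_wedge Q P) 1" if P: "P \<in> set_comps A" for P
  proof -
    have "m (comp_restrict P X, comp_restrict P (A - X))
      = (if X = B then Poly_Mapping.single (comp_wedge Q P) 1 else 0)" if "X \<in> Pow A" for X
      using that set_comps_Union[OF P] R
      by (auto simp: m_def Union_comp_restrict QBR comp_wedge_Cons comp_wedge_restrict Int_absorb1)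
    then show ?thesis
      using B(2) \<open>finite A\<close> by simp
  qed
  have "lin_ext m (coprod f) = lin_ext (\<lambda>P. Poly_Mapping.single (comp_wedge Q P) 1) f"
    unfolding coprod_def lin_ext_lin_ext
    by (rule lin_ext_cong)
      (simp add: Let_def set_comps_Union[OF keys] lin_ext_sum lin_ext_single m_term keys)
  moreover have "lin_ext m (tensor f empty_comp) = 0"
  proof -
    have "lin_ext m (tensor f empty_comp) = lin_ext (\<lambda>_. 0) f"
      unfolding tensor_empty_right lin_ext_lin_ext
      by (rule lin_ext_cong)
        (use \<open>B \<noteq> A\<close> in \<open>simp add: lin_ext_single m_def set_comps_Union[OF keys]\<close>)
    then show ?thesis by (simp add: lin_ext_const_zero)
  qed
  moreover have "lin_ext m (tensor empty_comp f) = 0"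
    unfolding tensor_empty_left lin_ext_lin_ext
    using B(1) by (simp add: lin_ext_single m_def lin_ext_const_zero)
  ultimately show ?thesis
    using f(2) by (simp add: basis_wedge primitive_def lin_ext_add)
qed

lemma wedge_primitive:
  assumes "finite A" "A \<noteq> {}" and f: "f \<in> FPi_on A" "primitive f" and g: "g \<in> FPi_on A"
  shows "wedge g f = scale (Poly_Mapping.lookup g [A]) f"
proof -
  have whole: "wedge (Poly_Mapping.single [A] 1) f = f"
  proof -
    have "wedge (Poly_Mapping.single [A] 1) f = lin_ext (\<lambda>P. Poly_Mapping.single P 1) f"
      unfolding basis_wedge
      by (rule lin_ext_cong) (use f(1) in \<open>auto simp: FPi_on_def comp_wedge_whole\<close>)
    then show ?thesis by (simp add: lin_ext_basis)
  qed
  have "wedge (Poly_Mapping.single Q 1) f = (if Q = [A] then f else 0)"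
    if "Q \<in> Poly_Mapping.keys g" for Q
  proof -
    have Q: "Q \<in> set_comps A"
      using g that by (auto simp: FPi_on_def)
    then have "Q \<noteq> []"
      using \<open>A \<noteq> {}\<close> set_comps_Union by fastforce
    then show ?thesis
      using whole basis_wedge_primitive[OF \<open>finite A\<close> f Q] by auto
  qed
  then have "wedge g f = lin_ext (\<lambda>Q. if Q = [A] then f else 0) g"
    unfolding wedge_conv_basis[of g] by (rule lin_ext_cong)
  also have "\<dots> = (\<Sum>Q\<in>Poly_Mapping.keys g.
      if Q = [A] then scale (Poly_Mapping.lookup g Q) f else 0)"
    unfolding lin_ext_def by (rule sum.cong) auto
  also have "\<dots> = scale (Poly_Mapping.lookup g [A]) f"
    by (simp add: in_keys_iff)
  finally show ?thesis .
qed

text \<open>The empty composition is group-like, and its coefficient \<open>c\<close> in a primitive element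
  supported on it would satisfy \<open>c = c + c\<close>.\<close>

lemma primitive_ground_set_nonempty:
  assumes f: "f \<in> FPi_on A" "primitive f" "f \<noteq> 0"
  shows "A \<noteq> {}"
proof
  assume "A = {}"
  then have "Poly_Mapping.keys f \<subseteq> {[]}"
    using f(1) by (auto simp: FPi_on_def set_comps_def partition_on_empty)
  then have f_eq: "f = Poly_Mapping.single [] (Poly_Mapping.lookup f [])"
    by (intro poly_mapping_eqI) (auto simp: lookup_single when_def in_keys_iff)
  let ?c = "Poly_Mapping.lookup f []"
  have "Poly_Mapping.lookup (coprod f) ([], []) = ?c"
    by (subst f_eq) (simp add: coprod_def lin_ext_single comp_restrict_def del_empty_def lookup_scale)
  moreover have "Poly_Mapping.lookup (tensor f empty_comp) ([], []) = ?c"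
    by (subst f_eq) (simp add: tensor_empty_right lin_ext_single lookup_scale)
  moreover have "Poly_Mapping.lookup (tensor empty_comp f) ([], []) = ?c"
    by (subst f_eq) (simp add: tensor_empty_left lin_ext_single lookup_scale)
  ultimately have "?c = ?c + ?c"
    using f(2) by (metis primitive_def lookup_add)
  then have "?c = 0"
    by (rule add_cancel_left_right[THEN iffD1, OF sym])
  with f_eq f(3) show False
    by simp
qed


section \<open>The action of the symmetric group\<close>

lemma comp_act_set_comps:
  assumes "\<pi> permutes A" "P \<in> set_comps A"
  shows "comp_act \<pi> P \<in> set_comps A"
proof -
  have inj: "inj \<pi>"
    by (rule permutes_inj[OF assms(1)])
  have "disjoint ((`) \<pi> ` set P)"
    using assms(2) inj
    by (intro disjoint_image) (auto simp: set_comps_def partition_on_def intro: inj_on_subset)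
  moreover have "\<Union>((`) \<pi> ` set P) = A"
    using set_comps_Union[OF assms(2)] permutes_image[OF assms(1)] by (metis image_Union)
  ultimately have "partition_on A ((`) \<pi> ` set P)"
    using assms(2) by (auto simp: set_comps_def partition_on_def)
  moreover have "distinct (map ((`) \<pi>) P)"
    using assms(2) inj by (auto simp: set_comps_def distinct_map inj_on_def inj_image_eq_iff)
  ultimately show ?thesis
    by (simp add: set_comps_def comp_act_def)
qed

lemma comp_act_restrict:
  assumes "inj \<pi>"
  shows "comp_restrict (comp_act \<pi> P) (\<pi> ` X) = comp_act \<pi> (comp_restrict P X)"
  unfolding comp_restrict_def comp_act_def del_empty_def
  by (induction P) (simp_all add: image_Int[OF assms, symmetric])

lemma act_compose: "act \<sigma> (act \<pi> f) = act (\<sigma> \<circ> \<pi>) f"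
  by (simp add: act_def lin_ext_lin_ext lin_ext_single comp_act_def image_comp o_def)

lemma FPi_on_act:
  assumes "\<pi> permutes A" "f \<in> FPi_on A"
  shows "act \<pi> f \<in> FPi_on A"
proof -
  have "\<exists>P\<in>Poly_Mapping.keys f. k = comp_act \<pi> P" if "k \<in> Poly_Mapping.keys (act \<pi> f)" for k
  proof (rule ccontr)
    assume "\<not> ?thesis"
    then have "Poly_Mapping.lookup (act \<pi> f) k = 0"
      by (auto simp: act_def lookup_lin_ext_superset[OF _ order_refl] lookup_single when_def
          intro!: sum.neutral)
    with that show False by (simp add: in_keys_iff)
  qed
  with assms(2) show ?thesis
    by (fastforce simp: FPi_on_def intro: comp_act_set_comps[OF assms(1)])
qed

lemma lookup_act:
  assumes "inj \<pi>"
  shows "Poly_Mapping.lookup (act \<pi> f) (comp_act \<pi> P) = Poly_Mapping.lookup f P"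
proof -
  have "comp_act \<pi> Q = comp_act \<pi> P \<longleftrightarrow> Q = P" for Q
    using assms by (auto simp: comp_act_def inj_map_eq_map inj_def inj_image_eq_iff)
  then have "Poly_Mapping.lookup (act \<pi> f) (comp_act \<pi> P)
    = Poly_Mapping.lookup (lin_ext (\<lambda>P. Poly_Mapping.single P 1) f) P"
    by (simp add: act_def lookup_lin_ext_superset[OF _ order_refl] lookup_single when_def)
  then show ?thesis by (simp add: lin_ext_basis)
qed

text \<open>The coproduct is equivariant when the action on tensors is the diagonal one: the summand of
  \<open>P\<close> at a subset \<open>X\<close> of its ground set is carried to the summand of \<open>\<pi>(P)\<close> at \<open>\<pi>(X)\<close>.\<close>

lemma coprod_act:
  assumes "inj \<pi>"
  shows "coprod (act \<pi> f)
    = lin_ext (\<lambda>(S, T). Poly_Mapping.single (comp_act \<pi> S, comp_act \<pi> T) 1) (coprod f)"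
proof -
  have "(\<Sum>X\<in>Pow (\<Union>(set (comp_act \<pi> P))). Poly_Mapping.single
            (comp_restrict (comp_act \<pi> P) X,
             comp_restrict (comp_act \<pi> P) (\<Union>(set (comp_act \<pi> P)) - X)) 1)
      = (\<Sum>X\<in>Pow (\<Union>(set P)). Poly_Mapping.single
            (comp_act \<pi> (comp_restrict P X),
             comp_act \<pi> (comp_restrict P (\<Union>(set P) - X))) (1::'a))" for P
  proof -
    have U: "\<Union>(set (comp_act \<pi> P)) = \<pi> ` \<Union>(set P)"
      by (auto simp: comp_act_def)
    have "bij_betw ((`) \<pi>) (Pow (\<Union>(set P))) (Pow (\<pi> ` \<Union>(set P)))"
      by (rule bij_betw_Pow) (use assms in \<open>auto simp: bij_betw_def inj_on_def\<close>)
    then show ?thesis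
      unfolding U
      by (rule sum.reindex_bij_betw[symmetric, THEN trans])
        (simp only: image_set_diff[OF assms, symmetric] comp_act_restrict[OF assms])
  qed
  then show ?thesis
    by (simp add: coprod_def act_def lin_ext_lin_ext lin_ext_single Let_def lin_ext_sum)
qed

lemma primitive_act:
  assumes "inj \<pi>" "primitive f"
  shows "primitive (act \<pi> f)"
  unfolding primitive_def coprod_act[OF assms(1)] assms(2)[unfolded primitive_def]
  by (simp add: lin_ext_add tensor_empty_left tensor_empty_right act_def lin_ext_lin_ext
      lin_ext_single comp_act_def)

lemma primitive_sum:
  assumes "\<And>i. i \<in> I \<Longrightarrow> primitive (f i)"
  shows "primitive (\<Sum>i\<in>I. f i)"
  using assms
  by (simp add: primitive_def coprod_def lin_ext_sum tensor_empty_left tensor_empty_right sum.distrib)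

lemma primitive_scale: "primitive f \<Longrightarrow> primitive (scale c f)"
  by (simp add: primitive_def coprod_def lin_ext_scale tensor_empty_left tensor_empty_right scale_add)

lemma orbit_sum_FPi_on:
  assumes "f \<in> FPi_on A"
  shows "orbit_sum A f \<in> FPi_on A"
  using Poly_Mapping.keys_sum[of "\<lambda>\<pi>. act \<pi> f" "{\<pi>. \<pi> permutes A}"] FPi_on_act[OF _ assms]
  by (fastforce simp: FPi_on_def orbit_sum_def)

lemma act_orbit_sum:
  assumes "\<sigma> permutes A"
  shows "act \<sigma> (orbit_sum A f) = orbit_sum A f"
proof -
  have "act \<sigma> (orbit_sum A f) = (\<Sum>\<pi> | \<pi> permutes A. act (\<sigma> \<circ> \<pi>) f)"
    by (simp add: orbit_sum_def act_compose[symmetric]) (simp add: act_def lin_ext_sum)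
  also have "\<dots> = orbit_sum A f"
    unfolding orbit_sum_def by (rule setum_permutations_compose_left[OF assms, symmetric])
  finally show ?thesis .
qed

text \<open>The composition \<open>(A)\<close> is a fixed point of the action, so each of the \<open>|A|!\<close> summands
  contributes the same coefficient.\<close>

lemma lookup_orbit_sum_whole:
  assumes "finite A"
  shows "Poly_Mapping.lookup (orbit_sum A f) [A] = fact (card A) * Poly_Mapping.lookup f [A]"
proof -
  have "Poly_Mapping.lookup (act \<pi> f) [A] = Poly_Mapping.lookup f [A]" if "\<pi> permutes A" for \<pi>
    using lookup_act[OF permutes_inj[OF that], of f "[A]"] permutes_image[OF that]
    by (simp add: comp_act_def)
  then show ?thesis
    by (simp add: orbit_sum_def lookup_sum card_permutations[OF refl assms])
qed

theorem proposition9p1: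
  fixes A :: "nat set" and n :: nat and E :: "nat set list \<Rightarrow>\<^sub>0 'f::field_char_0"
  assumes "finite A" and "A \<subseteq> {1..}" and "card A = n"
    and "E \<in> FPi_on A" and "delta_primitive_idempotent E"
  shows "scale (1 / fact n) (orbit_sum A E) \<in> invariants A \<and>
         delta_primitive_idempotent (scale (1 / fact n) (orbit_sum A E))"
proof -
  let ?G = "scale (1 / fact n) (orbit_sum A E)"
  have E: "primitive E" "E \<noteq> 0" "wedge E E = E"
    using assms(5) by (auto simp: delta_primitive_idempotent_def primitive_def)
  have "A \<noteq> {}"
    by (rule primitive_ground_set_nonempty[OF assms(4) E(1,2)])
  have coeff_E: "Poly_Mapping.lookup E [A] = 1"
  proof -
    have "scale (Poly_Mapping.lookup E [A]) E = E"
      using wedge_primitive[OF assms(1) \<open>A \<noteq> {}\<close> assms(4) E(1) assms(4)] E(3) by simp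
    moreover obtain P where "Poly_Mapping.lookup E P \<noteq> 0"
      using E(2) by (metis lookup_zero poly_mapping_eqI)
    ultimately show ?thesis
      by (metis lookup_scale mult_cancel_right1)
  qed
  have coeff_G: "Poly_Mapping.lookup ?G [A] = 1"
    using assms(1,3) by (simp add: lookup_scale lookup_orbit_sum_whole coeff_E)
  have G_on: "?G \<in> FPi_on A"
    using orbit_sum_FPi_on[OF assms(4)] keys_scale[of "1 / fact n" "orbit_sum A E"]
    by (auto simp: FPi_on_def)
  have G_prim: "primitive ?G"
    unfolding orbit_sum_def
    by (intro primitive_scale primitive_sum primitive_act E(1)) (auto intro: permutes_inj)
  have "?G \<in> invariants A"
  proof -
    have "act \<sigma> ?G = ?G" if "\<sigma> permutes A" for \<sigma>
      using act_orbit_sum[OF that, of E] by (simp add: act_def lin_ext_scale)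
    then show ?thesis using G_on by (simp add: invariants_def)
  qed
  moreover have "?G \<in> FPi"
    using G_on assms(1,2) by (auto simp: FPi_on_def FPi_def)
  moreover have "?G \<noteq> 0"
    using coeff_G by auto
  moreover have "wedge ?G ?G = ?G"
    using wedge_primitive[OF assms(1) \<open>A \<noteq> {}\<close> G_on G_prim G_on] coeff_G by simp
  ultimately show ?thesis
    using G_prim by (simp add: delta_primitive_idempotent_def primitive_def)
qed

end
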